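(* There exist a group $G$ and an automorphism $\varphi$ of $G$ such that the $\varphi$-conjugacy class $[e]_{\varphi}$ of the unit element is a subgroup of $G$, but the equality $R(\varphi)=|G:[e]_{\varphi}|$ does not hold.
   Context: For an automorphism $\varphi$ of a group $G$, elements $x,y\in G$ are $\varphi$-conjugated if $y=z^{-1}xz^{\varphi}$ for some $z\in G$, where $z^\varphi$ is the image of $z$ under $\varphi$; this is an equivalence relation, and $[x]_{\varphi}$ denotes the class of $x$. $R(\varphi)$ (the Reidemeister number of $\varphi$) is the number of $\varphi$-conjugacy classes in $G$. *)

theory Defs
  imports "HOL-Algebra.Bij" "HOL-Algebra.Coset" "HOL-Library.Extended_Nat"
begin

text \<open>Number of elements of a set, with \<open>\<infinity>\<close> for infinite sets (where \<^const>\<open>card\<close> would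
  return 0).\<close>

definition ecard :: "'a set \<Rightarrow> enat"
  where "ecard A = (if finite A then enat (card A) else \<infinity>)"

definition twisted_conj :: "('a, 'b) monoid_scheme \<Rightarrow> ('a \<Rightarrow> 'a) \<Rightarrow> ('a \<times> 'a) set"
  where "twisted_conj G \<phi> =
    {(x, y). x \<in> carrier G \<and> y \<in> carrier G \<and>
       (\<exists>z\<in>carrier G. y = inv\<^bsub>G\<^esub> z \<otimes>\<^bsub>G\<^esub> x \<otimes>\<^bsub>G\<^esub> \<phi> z)}"

definition twisted_class :: "('a, 'b) monoid_scheme \<Rightarrow> ('a \<Rightarrow> 'a) \<Rightarrow> 'a \<Rightarrow> 'a set"
  where "twisted_class G \<phi> x = twisted_conj G \<phi> `` {x}"

definition reidemeister_number :: "('a, 'b) monoid_scheme \<Rightarrow> ('a \<Rightarrow> 'a) \<Rightarrow> enat"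
  where "reidemeister_number G \<phi> = ecard (carrier G // twisted_conj G \<phi>)"

definition subgroup_index :: "('a, 'b) monoid_scheme \<Rightarrow> 'a set \<Rightarrow> enat"
  where "subgroup_index G H = ecard (rcosets\<^bsub>G\<^esub> H)"

lemma equiv_twisted_conj:
  assumes "group G" and "\<phi> \<in> auto G"
  shows "equiv (carrier G) (twisted_conj G \<phi>)"
proof -
  interpret group G by fact
  have \<phi>: "\<phi> \<in> hom G G" using assms(2) by (simp add: auto_def)
  interpret group_hom G G \<phi> by unfold_locales (rule \<phi>)
  show ?thesis
  proof (rule equivI)
    show "twisted_conj G \<phi> \<subseteq> carrier G \<times> carrier G"
      by (auto simp: twisted_conj_def)
    show "refl_on (carrier G) (twisted_conj G \<phi>)"
      by (rule refl_onI) (auto simp: twisted_conj_def intro!: bexI[of _ "\<one>\<^bsub>G\<^esub>"])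
    show "sym (twisted_conj G \<phi>)"
    proof (rule symI)
      fix x y assume "(x, y) \<in> twisted_conj G \<phi>"
      then obtain z where z: "z \<in> carrier G" "x \<in> carrier G" "y \<in> carrier G"
        and y: "y = inv\<^bsub>G\<^esub> z \<otimes>\<^bsub>G\<^esub> x \<otimes>\<^bsub>G\<^esub> \<phi> z"
        by (auto simp: twisted_conj_def)
      have "z \<otimes>\<^bsub>G\<^esub> y = x \<otimes>\<^bsub>G\<^esub> \<phi> z"
        using z by (simp add: y m_assoc[symmetric])
      then have "x = inv\<^bsub>G\<^esub> (inv\<^bsub>G\<^esub> z) \<otimes>\<^bsub>G\<^esub> y \<otimes>\<^bsub>G\<^esub> \<phi> (inv\<^bsub>G\<^esub> z)"
        using z by (simp add: m_assoc)
      then show "(y, x) \<in> twisted_conj G \<phi>"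
        using z inv_closed[OF z(1)] unfolding twisted_conj_def by blast
    qed
    show "trans (twisted_conj G \<phi>)"
    proof (rule transI)
      fix x y w assume "(x, y) \<in> twisted_conj G \<phi>" "(y, w) \<in> twisted_conj G \<phi>"
      then obtain z u where z: "z \<in> carrier G" "u \<in> carrier G" "x \<in> carrier G" "w \<in> carrier G"
        and w: "w = inv\<^bsub>G\<^esub> u \<otimes>\<^bsub>G\<^esub> (inv\<^bsub>G\<^esub> z \<otimes>\<^bsub>G\<^esub> x \<otimes>\<^bsub>G\<^esub> \<phi> z) \<otimes>\<^bsub>G\<^esub> \<phi> u"
        by (auto simp: twisted_conj_def)
      have "w = inv\<^bsub>G\<^esub> (z \<otimes>\<^bsub>G\<^esub> u) \<otimes>\<^bsub>G\<^esub> x \<otimes>\<^bsub>G\<^esub> \<phi> (z \<otimes>\<^bsub>G\<^esub> u)"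
        using z by (simp add: w inv_mult_group m_assoc)
      then show "(x, w) \<in> twisted_conj G \<phi>"
        using z m_closed[OF z(1,2)] unfolding twisted_conj_def by blast
    qed
  qed
qed

end

theory Submission
  imports Defs
begin

text \<open>For the identity automorphism, twisted conjugacy is ordinary conjugacy. The class of the
  unit is then the trivial subgroup, whose index is the order of the group, while the Reidemeister
  number is the class number. In a finite group these two numbers agree only if every conjugacy
  class is a singleton, that is, only if the group is abelian. So every finite nonabelian group
  with its identity automorphism is a counterexample (\<open>reidemeister_less_index\<close>), and it remains
  to realise one, the symmetric group on three letters, on a set of natural numbers.\<close>

text \<open>Automorphisms are extensional functions, so the identity has to be restricted to the
  carrier.\<close>

abbreviation id_auto :: "('a, 'b) monoid_scheme \<Rightarrow> 'a \<Rightarrow> 'a"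
  where "id_auto G \<equiv> \<lambda>x\<in>carrier G. x"

lemma twisted_class_one_id_auto:
  assumes "group G"
  shows "twisted_class G (id_auto G) \<one>\<^bsub>G\<^esub> = {\<one>\<^bsub>G\<^esub>}"
proof -
  interpret group G by fact
  show ?thesis
    by (auto simp: twisted_class_def twisted_conj_def intro!: bexI[of _ "\<one>\<^bsub>G\<^esub>"])
qed

text \<open>The map sending an element to its conjugacy class is onto the set of classes, but
  it identifies \<open>a \<otimes> b\<close> and \<open>b \<otimes> a\<close>; on a finite group, the classes are therefore strictly fewer
  than the elements as soon as two elements do not commute.\<close>

lemma reidemeister_less_index:
  assumes "group G" and fin: "finite (carrier G)"
    and ab: "a \<in> carrier G" "b \<in> carrier G" "a \<otimes>\<^bsub>G\<^esub> b \<noteq> b \<otimes>\<^bsub>G\<^esub> a"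
  shows "reidemeister_number G (id_auto G)
    < subgroup_index G (twisted_class G (id_auto G) \<one>\<^bsub>G\<^esub>)"
proof -
  interpret group G by fact
  let ?R = "twisted_conj G (id_auto G)"
  let ?cl = "\<lambda>x. ?R `` {x}"
  have "id_auto G \<in> auto G"
    using group.id_in_auto[OF \<open>group G\<close>] by simp
  with \<open>group G\<close> have eq: "equiv (carrier G) ?R"
    by (rule equiv_twisted_conj)
  have quot: "carrier G // ?R = ?cl ` carrier G"
    by (auto simp: quotient_def)
  have "b \<otimes>\<^bsub>G\<^esub> a = inv\<^bsub>G\<^esub> a \<otimes>\<^bsub>G\<^esub> (a \<otimes>\<^bsub>G\<^esub> b) \<otimes>\<^bsub>G\<^esub> a"
    using ab by (simp add: m_assoc[symmetric])
  then have "(a \<otimes>\<^bsub>G\<^esub> b, b \<otimes>\<^bsub>G\<^esub> a) \<in> ?R"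
    using ab by (auto simp: twisted_conj_def intro!: bexI[of _ a])
  then have "?cl (a \<otimes>\<^bsub>G\<^esub> b) = ?cl (b \<otimes>\<^bsub>G\<^esub> a)"
    by (rule equiv_class_eq[OF eq])
  then have "\<not> inj_on ?cl (carrier G)"
    using ab by (auto dest: inj_onD)
  then have less: "card (carrier G // ?R) < card (carrier G)"
    using fin card_image_le[OF fin, of ?cl] eq_card_imp_inj_on[OF fin, of ?cl]
    by (auto simp: quot le_less)
  have "card (rcosets\<^bsub>G\<^esub> {\<one>\<^bsub>G\<^esub>}) = card (carrier G)"
    using lagrange[OF triv_subgroup] by (simp add: order_def)
  moreover have "finite (rcosets\<^bsub>G\<^esub> {\<one>\<^bsub>G\<^esub>})"
    using fin by (simp add: RCOSETS_def)
  moreover have "finite (carrier G // ?R)"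
    using fin by (simp add: quot)
  ultimately show ?thesis
    using less unfolding twisted_class_one_id_auto[OF \<open>group G\<close>]
    by (simp add: reidemeister_number_def subgroup_index_def ecard_def)
qed

text \<open>The residues modulo 6 with a twisted addition: since \<open>5 = -1\<close> modulo 6, the product of
  \<open>m\<close> and \<open>n\<close> is \<open>m + n\<close> for even \<open>m\<close> and \<open>m - n\<close> for odd \<open>m\<close>. The even residues are the
  rotations of a triangle and the odd ones its reflections.\<close>

definition S3 :: "nat monoid"
  where "S3 = \<lparr>carrier = {..<6}, mult = (\<lambda>m n. (m + 5 ^ m * n) mod 6), one = 0\<rparr>"

lemma carrier_S3: "carrier S3 = {0, 1, 2, 3, 4, 5}"
  by (auto simp: S3_def)

lemma group_S3: "group S3"
proof (rule groupI)
  fix x y z assume "x \<in> carrier S3" "y \<in> carrier S3" "z \<in> carrier S3"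
  then show "x \<otimes>\<^bsub>S3\<^esub> y \<otimes>\<^bsub>S3\<^esub> z = x \<otimes>\<^bsub>S3\<^esub> (y \<otimes>\<^bsub>S3\<^esub> z)"
    unfolding carrier_S3 by (elim insertE emptyE; simp add: S3_def)
next
  fix x assume "x \<in> carrier S3"
  then show "\<exists>y\<in>carrier S3. y \<otimes>\<^bsub>S3\<^esub> x = \<one>\<^bsub>S3\<^esub>"
    unfolding carrier_S3 by (elim insertE emptyE; simp add: S3_def)
qed (simp_all add: S3_def)

theorem mainTheorem13:
  "\<exists>(G :: nat monoid) (\<phi> :: nat \<Rightarrow> nat).
     group G \<and> \<phi> \<in> auto G \<and>
     subgroup (twisted_class G \<phi> \<one>\<^bsub>G\<^esub>) G \<and>
     reidemeister_number G \<phi> \<noteq> subgroup_index G (twisted_class G \<phi> \<one>\<^bsub>G\<^esub>)"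
proof (intro exI conjI)
  show "group S3" by (rule group_S3)
  then show "id_auto S3 \<in> auto S3" by (rule group.id_in_auto)
  show "subgroup (twisted_class S3 (id_auto S3) \<one>\<^bsub>S3\<^esub>) S3"
    unfolding twisted_class_one_id_auto[OF group_S3]
    by (rule group.triv_subgroup[OF group_S3])
  have "1 \<otimes>\<^bsub>S3\<^esub> 2 \<noteq> 2 \<otimes>\<^bsub>S3\<^esub> 1"
    by (simp add: S3_def)
  then show "reidemeister_number S3 (id_auto S3)
      \<noteq> subgroup_index S3 (twisted_class S3 (id_auto S3) \<one>\<^bsub>S3\<^esub>)"
    using reidemeister_less_index[OF group_S3, of 1 2] by (simp add: carrier_S3)
qed

end
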